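(* For every integer $n\ge 4$, $[2,2,1^{n-4}]\nsucc[2,1^{n-2}]$ in the Aldous order; that is, it is not the case that $\lambda_1(A;[2,2,1^{n-4}])\le\lambda_1(A;[2,1^{n-2}])$ for all families $A=\{a_{i,j}\}_{1\le i<j\le n}$ of non-negative real numbers.
   Context: Irreducible representations of the symmetric group $S_n$ are indexed by partitions $r_1\ge r_2\ge\dots\ge r_m>0$ of $n$ and denoted $[r_1,\dots,r_m]$ (the Specht module indexing, in which $[n]$ is the trivial representation and $[1^n]$ is the sign representation); $1^j$ means that the part $1$ is repeated $j$ times. All representations are finite dimensional and taken to be unitary. For a family $A=\{a_{i,j}\}_{1\le i<j\le n}$ of non-negative real numbers, let $\Delta_A=\sum_{i<j}a_{i,j}(\mathrm{id}-(ij))\in\mathbb{R}[S_n]$, where $(ij)$ is the transposition of $i$ and $j$. For a representation $\rho$ of $S_n$, $\rho(\Delta_A)$ is positive semidefinite, and $\lambda_1(A;\rho)$ denotes its smallest eigenvalue. The Aldous order on irreducible representations of $S_n$: $\rho\preceq\sigma$ if and only if $\lambda_1(A;\rho)\ge\lambda_1(A;\sigma)$ for all families $A$ of non-negative reals; $\sigma\succ\rho$ means $\rho\preceq\sigma$ and $\rho\neq\sigma$. *)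

theory Defs
  imports Complex_Main "HOL-Library.Function_Algebras" "HOL-Combinatorics.Permutations"
begin

text \<open>
  The symmetric group \<open>S\<^sub>n\<close> consists of the functions \<open>\<pi>\<close> with \<open>\<pi> permutes {1..n}\<close>.
  A partition is the list of its parts; rows and columns of its Young diagram are counted from 0.
\<close>

definition cells :: "nat list \<Rightarrow> (nat \<times> nat) set" where
  "cells \<mu> = {(i, j). i < length \<mu> \<and> j < \<mu> ! i}"

text \<open>The values of \<open>t\<close> outside \<open>cells \<mu>\<close> are irrelevant: nothing below depends on them.\<close>

definition tableau :: "nat \<Rightarrow> nat list \<Rightarrow> (nat \<times> nat \<Rightarrow> nat) \<Rightarrow> bool" where
  "tableau n \<mu> t \<longleftrightarrow> bij_betw t (cells \<mu>) {1..n}"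

text \<open>
  A tabloid (a tableau up to permutations within each row) is encoded as its sequence of row sets,
  which is empty from index \<open>length \<mu>\<close> on.
\<close>

type_synonym tabloid = "nat \<Rightarrow> nat set"

definition tabloid_of :: "nat list \<Rightarrow> (nat \<times> nat \<Rightarrow> nat) \<Rightarrow> tabloid" where
  "tabloid_of \<mu> t = (\<lambda>i. {t (i, j) | j. (i, j) \<in> cells \<mu>})"

definition column :: "nat list \<Rightarrow> (nat \<times> nat \<Rightarrow> nat) \<Rightarrow> nat \<Rightarrow> nat set" where
  "column \<mu> t j = {t (i, j) | i. (i, j) \<in> cells \<mu>}"

definition column_stabilizer :: "nat \<Rightarrow> nat list \<Rightarrow> (nat \<times> nat \<Rightarrow> nat) \<Rightarrow> (nat \<Rightarrow> nat) set" where
  "column_stabilizer n \<mu> t = {\<pi>. \<pi> permutes {1..n} \<and> (\<forall>j. \<pi> ` column \<mu> t j = column \<mu> t j)}"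

text \<open>
  Formal complex linear combinations of tabloids are encoded by their coefficient functions.
  \<open>S\<^sub>n\<close> acts by \<open>\<pi> {T} = {\<pi> T}\<close>, extended linearly; on coefficients this is
  \<open>(\<pi> v)(T) = v(\<pi>\<^sup>-\<^sup>1 T)\<close>. The action is unitary for the inner product in which
  the tabloids are orthonormal.
\<close>

type_synonym tabvec = "tabloid \<Rightarrow> complex"

definition tabscale :: "complex \<Rightarrow> tabvec \<Rightarrow> tabvec" where
  "tabscale c v = (\<lambda>T. c * v T)"

interpretation tabvec: vector_space tabscale
  by unfold_locales (auto simp: tabscale_def algebra_simps fun_eq_iff)

definition act :: "(nat \<Rightarrow> nat) \<Rightarrow> tabvec \<Rightarrow> tabvec" where
  "act \<pi> v = (\<lambda>T. v (\<lambda>i. inv \<pi> ` T i))"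

definition single :: "tabloid \<Rightarrow> tabvec" where
  "single T = (\<lambda>T'. if T' = T then 1 else 0)"

definition polytabloid :: "nat \<Rightarrow> nat list \<Rightarrow> (nat \<times> nat \<Rightarrow> nat) \<Rightarrow> tabvec" where
  "polytabloid n \<mu> t =
     (\<Sum>\<pi>\<in>column_stabilizer n \<mu> t. tabscale (of_int (sign \<pi>)) (single (tabloid_of \<mu> (\<pi> \<circ> t))))"

definition specht :: "nat \<Rightarrow> nat list \<Rightarrow> tabvec set" where
  "specht n \<mu> = tabvec.span {polytabloid n \<mu> t | t. tableau n \<mu> t}"

text \<open>The operator by which \<open>\<Delta>\<^sub>A = \<Sum>\<^bsub>i<j\<^esub> a\<^bsub>i,j\<^esub> (id - (i j))\<close> acts.\<close>

definition laplacian :: "nat \<Rightarrow> (nat \<Rightarrow> nat \<Rightarrow> real) \<Rightarrow> tabvec \<Rightarrow> tabvec" where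
  "laplacian n A v =
     (\<Sum>(i, j) | 1 \<le> i \<and> i < j \<and> j \<le> n.
        tabscale (of_real (A i j)) (v - act (transpose i j) v))"

text \<open>
  On \<open>specht n \<mu>\<close> the operator \<open>laplacian n A\<close> is Hermitian, so restricting to real eigenvalues loses nothing. For a partition
  \<open>\<mu>\<close> of \<open>n\<close> the Specht module is nonzero and finite dimensional, so \<open>Min\<close> is taken over a
  finite nonempty set.
\<close>

definition lambda1 :: "nat \<Rightarrow> (nat \<Rightarrow> nat \<Rightarrow> real) \<Rightarrow> nat list \<Rightarrow> real" where
  "lambda1 n A \<mu> =
     Min {l. \<exists>v\<in>specht n \<mu>. v \<noteq> 0 \<and> laplacian n A v = tabscale (of_real l) v}"

text \<open>
  The Aldous order on irreducible representations of \<open>S\<^sub>n\<close>, given by the partitions of \<open>n\<close>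
  indexing them. Only the entries \<open>A i j\<close> with \<open>1 \<le> i < j \<le> n\<close> matter.
\<close>

definition aldous_le :: "nat \<Rightarrow> nat list \<Rightarrow> nat list \<Rightarrow> bool" where
  "aldous_le n \<rho> \<sigma> \<longleftrightarrow>
     (\<forall>A. (\<forall>i j. 1 \<le> i \<and> i < j \<and> j \<le> n \<longrightarrow> A i j \<ge> 0) \<longrightarrow> lambda1 n A \<rho> \<ge> lambda1 n A \<sigma>)"

definition aldous_greater :: "nat \<Rightarrow> nat list \<Rightarrow> nat list \<Rightarrow> bool" where
  "aldous_greater n \<sigma> \<rho> \<longleftrightarrow> aldous_le n \<rho> \<sigma> \<and> \<rho> \<noteq> \<sigma>"

end

theory Submission imports Defs begin

text \<open>
  Take for \<open>A\<close> the star centred at \<open>1\<close>, so that \<open>\<Delta>\<^sub>A = (n - 1) - X\<close> with the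
  Jucys--Murphy type element \<open>X = \<Sum>\<^sub>j (1 j)\<close>. Consider a shape with two columns of heights
  \<open>m\<close> and \<open>k = n - m > 0\<close>. The Garnir relation \<open>e\<^sub>t = \<Sum>\<^sub>x (x p) e\<^sub>t\<close>, where \<open>x\<close> runs over the
  first column of \<open>t\<close> and \<open>p\<close> lies in the second, gives \<open>X e\<^sub>t = (2 - k) e\<^sub>t\<close> when \<open>1\<close> is in the
  second column. When \<open>1\<close> is in the first column, \<open>X e\<^sub>t + (m - 1) e\<^sub>t\<close> is a sum of polytabloids of the
  former kind. Hence \<open>\<Delta>\<^sub>A\<close> has smallest eigenvalue \<open>n + k - 3\<close>, which is \<open>n - 2\<close> for
  \<open>[2,1\<^bsup>n-2\<^esup>]\<close> and \<open>n - 1\<close> for \<open>[2,2,1\<^bsup>n-4\<^esup>]\<close>.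
\<close>

section \<open>Linear action of permutations on tabloid vectors and polytabloids\<close>

lemma act_add: "act \<sigma> (u + v) = act \<sigma> u + act \<sigma> v"
  and act_diff: "act \<sigma> (u - v) = act \<sigma> u - act \<sigma> v"
  and act_minus: "act \<sigma> (- v) = - act \<sigma> v"
  and act_scale: "act \<sigma> (tabscale c v) = tabscale c (act \<sigma> v)"
  by (auto simp: act_def tabscale_def fun_eq_iff)

lemma act_zero: "act \<sigma> 0 = 0"
  by (auto simp: act_def fun_eq_iff)

lemma act_sum: "act \<sigma> (\<Sum>x\<in>S. f x) = (\<Sum>x\<in>S. act \<sigma> (f x))"
proof (induction S rule: infinite_finite_induct)
  case (insert x F)
  then show ?case by (simp add: act_add del: plus_fun_apply)
qed (simp_all only: sum.infinite sum.empty act_zero not_False_eq_True)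

lemma act_act:
  assumes "bij \<sigma>" "bij \<tau>"
  shows "act \<sigma> (act \<tau> v) = act (\<sigma> \<circ> \<tau>) v"
  using assms by (simp add: act_def o_inv_distrib image_comp)

text \<open>\<open>act\<close> pulls coefficients back along \<open>inv \<sigma>\<close>, so a basis
  vector is pushed forward: the only tabloid that \<open>inv \<sigma>\<close> carries to
  \<open>T\<close> is \<open>\<sigma>\<close> applied to each row of \<open>T\<close>.\<close>

lemma act_single:
  assumes "bij \<sigma>"
  shows "act \<sigma> (single T) = single (\<lambda>i. \<sigma> ` T i)"
proof -
  have "(\<lambda>i. inv \<sigma> ` U i) = T \<longleftrightarrow> U = (\<lambda>i. \<sigma> ` T i)" for U :: tabloid
  proof
    assume "(\<lambda>i. inv \<sigma> ` U i) = T"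
    then show "U = (\<lambda>i. \<sigma> ` T i)"
      using image_f_inv_f[OF bij_is_surj[OF assms]] by (simp add: fun_eq_iff) metis
  next
    assume "U = (\<lambda>i. \<sigma> ` T i)"
    then show "(\<lambda>i. inv \<sigma> ` U i) = T"
      using image_inv_f_f[OF bij_is_inj[OF assms]] by simp
  qed
  then show ?thesis
    by (simp add: act_def single_def)
qed

lemma tabloid_of_comp: "tabloid_of \<mu> (\<sigma> \<circ> t) = (\<lambda>i. \<sigma> ` tabloid_of \<mu> t i)"
  by (auto simp: tabloid_of_def fun_eq_iff)

lemma column_comp: "column \<mu> (\<sigma> \<circ> t) j = \<sigma> ` column \<mu> t j"
  by (auto simp: column_def)

lemma tableau_comp:
  assumes "tableau n \<mu> t" "\<sigma> permutes {1..n}"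
  shows "tableau n \<mu> (\<sigma> \<circ> t)"
  using assms permutes_imp_bij bij_betw_trans unfolding tableau_def by blast

lemma act_polytabloid_sum:
  assumes "bij \<sigma>"
  shows "act \<sigma> (polytabloid n \<mu> t) = (\<Sum>\<pi>\<in>column_stabilizer n \<mu> t.
     tabscale (of_int (sign \<pi>)) (single (tabloid_of \<mu> (\<sigma> \<circ> \<pi> \<circ> t))))"
  using assms
  by (simp add: polytabloid_def act_sum act_scale act_single tabloid_of_comp image_comp comp_assoc)

lemma permutes_conj:
  assumes "\<sigma> permutes S" "\<pi> permutes S"
  shows "\<sigma> \<circ> \<pi> \<circ> inv \<sigma> permutes S"
  using assms by (intro permutes_compose permutes_inv)

text \<open>The column stabilizer of \<open>\<sigma> \<circ> t\<close> is the conjugate by \<sigma>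
  of that of \<open>t\<close>. Conjugation preserves signs, so it reindexes one alternating sum into
  the other.\<close>

lemma act_polytabloid:
  assumes \<sigma>: "\<sigma> permutes {1..n}"
  shows "act \<sigma> (polytabloid n \<mu> t) = polytabloid n \<mu> (\<sigma> \<circ> t)"
proof -
  have b: "bij \<sigma>" using \<sigma> permutes_bij by blast
  have c1: "\<sigma> \<circ> inv \<sigma> = id" "inv \<sigma> \<circ> \<sigma> = id"
    using permutes_inv_o[OF \<sigma>] by auto
  have c: "f \<circ> inv \<sigma> \<circ> \<sigma> = f" "f \<circ> \<sigma> \<circ> inv \<sigma> = f"
    "inv \<sigma> (\<sigma> x) = x" "\<sigma> (inv \<sigma> x) = x" for f :: "nat \<Rightarrow> nat" and x
    using c1 by (auto simp: fun_eq_iff)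
  have "act \<sigma> (polytabloid n \<mu> t) = (\<Sum>\<pi>\<in>column_stabilizer n \<mu> t.
     tabscale (of_int (sign \<pi>)) (single (tabloid_of \<mu> (\<sigma> \<circ> \<pi> \<circ> t))))"
    by (rule act_polytabloid_sum[OF b])
  also have "\<dots> = polytabloid n \<mu> (\<sigma> \<circ> t)"
    unfolding polytabloid_def
  proof (rule sum.reindex_bij_witness[where i = "\<lambda>\<pi>. inv \<sigma> \<circ> \<pi> \<circ> \<sigma>" and j = "\<lambda>\<pi>. \<sigma> \<circ> \<pi> \<circ> inv \<sigma>"])
    fix \<pi> assume \<pi>: "\<pi> \<in> column_stabilizer n \<mu> t"
    then have p: "\<pi> permutes {1..n}" by (simp add: column_stabilizer_def)
    show "inv \<sigma> \<circ> (\<sigma> \<circ> \<pi> \<circ> inv \<sigma>) \<circ> \<sigma> = \<pi>"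
      by (auto simp: fun_eq_iff c)
    have "(\<sigma> \<circ> \<pi> \<circ> inv \<sigma>) ` column \<mu> (\<sigma> \<circ> t) j = column \<mu> (\<sigma> \<circ> t) j" for j
    proof -
      have "(\<sigma> \<circ> \<pi> \<circ> inv \<sigma>) ` column \<mu> (\<sigma> \<circ> t) j = \<sigma> ` \<pi> ` column \<mu> t j"
        unfolding column_comp image_comp by (rule arg_cong[where f = "\<lambda>f. f ` _"]) (simp add: fun_eq_iff c)
      then show ?thesis using \<pi> by (simp add: column_stabilizer_def column_comp)
    qed
    then show "\<sigma> \<circ> \<pi> \<circ> inv \<sigma> \<in> column_stabilizer n \<mu> (\<sigma> \<circ> t)"
      using permutes_conj[OF \<sigma> p] by (simp add: column_stabilizer_def)
    have P: "permutation \<sigma>" "permutation \<pi>" "permutation (inv \<sigma>)"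
      using \<sigma> p permutes_inv[OF \<sigma>] permutation_permutes by blast+
    have "sign (\<sigma> \<circ> \<pi> \<circ> inv \<sigma>) = sign \<pi>"
      using P sign_idempotent[of \<sigma>]
      by (simp add: sign_compose permutation_compose sign_inverse)
    moreover have "\<sigma> \<circ> \<pi> \<circ> inv \<sigma> \<circ> (\<sigma> \<circ> t) = \<sigma> \<circ> \<pi> \<circ> t"
      by (auto simp: fun_eq_iff c)
    ultimately show "tabscale (of_int (sign (\<sigma> \<circ> \<pi> \<circ> inv \<sigma>)))
          (single (tabloid_of \<mu> (\<sigma> \<circ> \<pi> \<circ> inv \<sigma> \<circ> (\<sigma> \<circ> t)))) =
        tabscale (of_int (sign \<pi>)) (single (tabloid_of \<mu> (\<sigma> \<circ> \<pi> \<circ> t)))"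
      by simp
  next
    fix \<pi> assume \<pi>: "\<pi> \<in> column_stabilizer n \<mu> (\<sigma> \<circ> t)"
    then have p: "\<pi> permutes {1..n}" by (simp add: column_stabilizer_def)
    show "\<sigma> \<circ> (inv \<sigma> \<circ> \<pi> \<circ> \<sigma>) \<circ> inv \<sigma> = \<pi>"
      by (auto simp: fun_eq_iff c)
    have "(inv \<sigma> \<circ> \<pi> \<circ> \<sigma>) ` column \<mu> t j = column \<mu> t j" for j
    proof -
      have "\<pi> ` \<sigma> ` column \<mu> t j = \<sigma> ` column \<mu> t j"
        using \<pi> by (simp add: column_stabilizer_def column_comp)
      then have "inv \<sigma> ` \<pi> ` \<sigma> ` column \<mu> t j = inv \<sigma> ` \<sigma> ` column \<mu> t j"
        by simp
      then show ?thesis by (simp add: image_comp comp_def c)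
    qed
    then show "inv \<sigma> \<circ> \<pi> \<circ> \<sigma> \<in> column_stabilizer n \<mu> t"
      using p \<sigma> by (auto simp: column_stabilizer_def intro!: permutes_compose permutes_inv)
  qed
  finally show ?thesis .
qed

text \<open>Left multiplication by \<sigma> permutes the column stabilizer and multiplies every sign
  by \<open>sign \<sigma>\<close>, which factors out of the sum.\<close>

lemma act_polytabloid_column_stabilizer:
  assumes \<sigma>: "\<sigma> \<in> column_stabilizer n \<mu> t"
  shows "act \<sigma> (polytabloid n \<mu> t) = tabscale (of_int (sign \<sigma>)) (polytabloid n \<mu> t)"
proof -
  have p\<sigma>: "\<sigma> permutes {1..n}" using \<sigma> by (simp add: column_stabilizer_def)
  have b: "bij \<sigma>" using p\<sigma> permutes_bij by blast
  have c: "inv \<sigma> (\<sigma> x) = x" "\<sigma> (inv \<sigma> x) = x" for x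
    using permutes_inverses[OF p\<sigma>] by auto
  have "tabscale (of_int (sign \<sigma>)) (polytabloid n \<mu> t) = (\<Sum>\<pi>\<in>column_stabilizer n \<mu> t.
     tabscale (of_int (sign \<sigma>)) (tabscale (of_int (sign \<pi>)) (single (tabloid_of \<mu> (\<pi> \<circ> t)))))"
    by (simp add: polytabloid_def tabvec.scale_sum_right)
  also have "\<dots> = (\<Sum>\<pi>\<in>column_stabilizer n \<mu> t.
     tabscale (of_int (sign \<pi>)) (single (tabloid_of \<mu> (\<sigma> \<circ> \<pi> \<circ> t))))"
  proof (rule sum.reindex_bij_witness[where j = "\<lambda>\<pi>. inv \<sigma> \<circ> \<pi>" and i = "\<lambda>\<pi>. \<sigma> \<circ> \<pi>"])
    fix \<pi> assume \<pi>: "\<pi> \<in> column_stabilizer n \<mu> t"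
    then have p: "\<pi> permutes {1..n}" by (simp add: column_stabilizer_def)
    show "\<sigma> \<circ> (inv \<sigma> \<circ> \<pi>) = \<pi>" "inv \<sigma> \<circ> (\<sigma> \<circ> \<pi>) = \<pi>"
      by (auto simp: fun_eq_iff c)
    have "inv \<sigma> ` column \<mu> t j = column \<mu> t j" for j
    proof -
      have "inv \<sigma> ` \<sigma> ` column \<mu> t j = inv \<sigma> ` column \<mu> t j"
        using \<sigma> by (simp add: column_stabilizer_def)
      then show ?thesis by (simp add: image_comp comp_def c)
    qed
    moreover have "\<pi> ` column \<mu> t j = column \<mu> t j" for j
      using \<pi> by (simp add: column_stabilizer_def)
    ultimately have "(inv \<sigma> \<circ> \<pi>) ` column \<mu> t j = column \<mu> t j" for j
      by (metis image_comp)
    then show "inv \<sigma> \<circ> \<pi> \<in> column_stabilizer n \<mu> t"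
      using permutes_compose[OF p permutes_inv[OF p\<sigma>]]
      by (simp add: column_stabilizer_def)
    have "\<pi> ` column \<mu> t j = column \<mu> t j" "\<sigma> ` column \<mu> t j = column \<mu> t j" for j
      using \<pi> \<sigma> by (simp_all add: column_stabilizer_def)
    then have "(\<sigma> \<circ> \<pi>) ` column \<mu> t j = column \<mu> t j" for j
      by (metis image_comp)
    then show "\<sigma> \<circ> \<pi> \<in> column_stabilizer n \<mu> t"
      using permutes_compose[OF p p\<sigma>]
      by (simp add: column_stabilizer_def)
    have P: "permutation \<pi>" "permutation (inv \<sigma>)" "permutation \<sigma>"
      using p\<sigma> p permutes_inv[OF p\<sigma>] permutation_permutes by blast+
    have "sign (inv \<sigma> \<circ> \<pi>) = sign \<sigma> * sign \<pi>"
      using P by (simp add: sign_compose sign_inverse)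
    moreover have "\<sigma> \<circ> (inv \<sigma> \<circ> \<pi>) \<circ> t = \<pi> \<circ> t"
      by (auto simp: fun_eq_iff c)
    ultimately show "tabscale (of_int (sign (inv \<sigma> \<circ> \<pi>)))
          (single (tabloid_of \<mu> (\<sigma> \<circ> (inv \<sigma> \<circ> \<pi>) \<circ> t))) =
        tabscale (of_int (sign \<sigma>)) (tabscale (of_int (sign \<pi>)) (single (tabloid_of \<mu> (\<pi> \<circ> t))))"
      by simp
  qed
  also have "\<dots> = act \<sigma> (polytabloid n \<mu> t)"
    by (rule act_polytabloid_sum[OF b, symmetric])
  finally show ?thesis by simp
qed

section \<open>Entries and columns of a tableau\<close>

lemma tableau_in_range:
  assumes "tableau n \<mu> t" "z \<in> cells \<mu>"
  shows "t z \<in> {1..n}"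
  using assms by (auto simp: tableau_def bij_betw_def)

lemma tableau_eq_iff:
  assumes "tableau n \<mu> t" "z \<in> cells \<mu>" "z' \<in> cells \<mu>"
  shows "t z = t z' \<longleftrightarrow> z = z'"
  using assms by (auto simp: tableau_def bij_betw_def inj_on_eq_iff)

lemma tableau_surj:
  assumes "tableau n \<mu> t" "x \<in> {1..n}"
  shows "\<exists>i j. (i, j) \<in> cells \<mu> \<and> x = t (i, j)"
proof -
  have "x \<in> t ` cells \<mu>" using assms by (auto simp: tableau_def bij_betw_def)
  then show ?thesis by auto
qed

lemma column_subset:
  assumes "tableau n \<mu> t"
  shows "column \<mu> t j \<subseteq> {1..n}"
  using tableau_in_range[OF assms] by (auto simp: column_def)

lemma column_disjoint:
  assumes "tableau n \<mu> t" "x \<in> column \<mu> t j" "x \<in> column \<mu> t k"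
  shows "j = k"
  using assms tableau_eq_iff[OF assms(1)] by (auto simp: column_def)

text \<open>Columns are disjoint, so the transposition fixes every other column pointwise. It is
  therefore an odd element of the column stabilizer.\<close>

lemma act_transpose_column:
  assumes t: "tableau n \<mu> t" and ab: "a \<in> column \<mu> t j" "b \<in> column \<mu> t j" "a \<noteq> b"
  shows "act (transpose a b) (polytabloid n \<mu> t) = - polytabloid n \<mu> t"
proof -
  have "transpose a b ` column \<mu> t k = column \<mu> t k" for k
  proof (cases "k = j")
    case True
    then show ?thesis using ab by simp
  next
    case False
    then have "a \<notin> column \<mu> t k" "b \<notin> column \<mu> t k"
      using column_disjoint[OF t] ab by blast+
    then show ?thesis by simp
  qed
  moreover have "transpose a b permutes {1..n}"
    using subsetD[OF column_subset[OF t]] ab by (intro permutes_swap_id)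
  ultimately have "transpose a b \<in> column_stabilizer n \<mu> t"
    by (simp add: column_stabilizer_def)
  from act_polytabloid_column_stabilizer[OF this] show ?thesis
    using ab by (simp add: sign_swap_id tabscale_def fun_eq_iff)
qed

section \<open>Tabloids in the support of a polytabloid\<close>

text \<open>The type \<open>tabloid\<close> contains arbitrary sequences of sets. This singles out
  those that split \<open>{1..n}\<close> into rows with index below \<open>m\<close>; the row
  function \<open>f\<close> is the map to which the pigeonhole principle is applied later.\<close>

definition row_partition :: "nat \<Rightarrow> nat \<Rightarrow> tabloid \<Rightarrow> bool" where
  "row_partition n m T \<longleftrightarrow>
     (\<exists>f. (\<forall>x\<in>{1..n}. f x < m) \<and> (\<forall>i. T i = {x \<in> {1..n}. f x = i}))"

lemma row_partition_tabloid_of: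
  assumes t: "tableau n \<mu> t"
  shows "row_partition n (length \<mu>) (tabloid_of \<mu> t)"
proof -
  define f where "f x = fst (the_inv_into (cells \<mu>) t x)" for x
  have inj: "inj_on t (cells \<mu>)" using t by (simp add: tableau_def bij_betw_def)
  have f: "f (t (i, j)) = i" if "(i, j) \<in> cells \<mu>" for i j
    using the_inv_into_f_f[OF inj that] by (simp add: f_def)
  have "f x < length \<mu>" if "x \<in> {1..n}" for x
  proof -
    obtain i j where ij: "(i, j) \<in> cells \<mu>" "x = t (i, j)"
      using tableau_surj[OF t \<open>x \<in> {1..n}\<close>] by blast
    then show ?thesis using f by (simp add: cells_def)
  qed
  moreover have "tabloid_of \<mu> t i = {x \<in> {1..n}. f x = i}" for i
  proof
    show "tabloid_of \<mu> t i \<subseteq> {x \<in> {1..n}. f x = i}"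
      using f tableau_in_range[OF t] by (auto simp: tabloid_of_def)
    show "{x \<in> {1..n}. f x = i} \<subseteq> tabloid_of \<mu> t i"
    proof
      fix x assume x: "x \<in> {x \<in> {1..n}. f x = i}"
      then obtain i' j where "(i', j) \<in> cells \<mu>" "x = t (i', j)"
        using tableau_surj[OF t, of x] by blast
      then show "x \<in> tabloid_of \<mu> t i" using f x by (auto simp: tabloid_of_def)
    qed
  qed
  ultimately show ?thesis unfolding row_partition_def by blast
qed

lemma sum_fun_apply: "(\<Sum>x\<in>S. f x) y = (\<Sum>x\<in>S. f x y)"
  by (induction S rule: infinite_finite_induct) auto

lemma polytabloid_support:
  assumes t: "tableau n \<mu> t" and "polytabloid n \<mu> t T \<noteq> 0"
  shows "row_partition n (length \<mu>) T"
proof -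
  obtain \<pi> where \<pi>: "\<pi> \<in> column_stabilizer n \<mu> t" "single (tabloid_of \<mu> (\<pi> \<circ> t)) T \<noteq> 0"
    using assms(2) unfolding polytabloid_def sum_fun_apply
    by (metis (no_types, lifting) mult_zero_right sum.neutral tabscale_def)
  then have "T = tabloid_of \<mu> (\<pi> \<circ> t)" by (auto simp: single_def split: if_splits)
  then show ?thesis
    using row_partition_tabloid_of tableau_comp[OF t] \<pi>(1) by (simp add: column_stabilizer_def)
qed

text \<open>Only the identity contributes to this coefficient: if \<pi> preserves all columns and
  the tabloid of \<open>t\<close>, then the image of the entry at \<open>(i, j)\<close> stays in row
  \<open>i\<close> and in column \<open>j\<close>, hence is that entry. In particular polytabloids
  are nonzero.\<close>

lemma polytabloid_tabloid_of:
  assumes t: "tableau n \<mu> t"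
  shows "polytabloid n \<mu> t (tabloid_of \<mu> t) = 1"
proof -
  have id: "\<pi> = id" if \<pi>: "\<pi> \<in> column_stabilizer n \<mu> t" and eq: "tabloid_of \<mu> (\<pi> \<circ> t) = tabloid_of \<mu> t" for \<pi>
  proof
    fix x
    have p: "\<pi> permutes {1..n}" using \<pi> by (simp add: column_stabilizer_def)
    show "\<pi> x = id x"
    proof (cases "x \<in> {1..n}")
      case False
      then show ?thesis using p by (metis permutes_def id_apply)
    next
      case True
      then obtain i j where ij: "(i, j) \<in> cells \<mu>" "x = t (i, j)"
        using tableau_surj[OF t, of x] by blast
      have "x \<in> column \<mu> t j" using ij by (auto simp: column_def)
      then have "\<pi> x \<in> column \<mu> t j" using \<pi> by (auto simp: column_stabilizer_def)
      then obtain i' where i': "(i', j) \<in> cells \<mu>" "\<pi> x = t (i', j)" by (auto simp: column_def)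
      have "\<pi> x \<in> tabloid_of \<mu> (\<pi> \<circ> t) i" using ij by (auto simp: tabloid_of_def)
      then obtain j' where j': "(i, j') \<in> cells \<mu>" "\<pi> x = t (i, j')"
        unfolding eq by (auto simp: tabloid_of_def)
      show ?thesis using tableau_eq_iff[OF t i'(1) j'(1)] i' j' ij by simp
    qed
  qed
  have fin: "finite (column_stabilizer n \<mu> t)"
    by (rule finite_subset[OF _ finite_permutations[of "{1..n}"]]) (auto simp: column_stabilizer_def)
  have idm: "id \<in> column_stabilizer n \<mu> t"
    by (simp add: column_stabilizer_def permutes_id)
  have "polytabloid n \<mu> t (tabloid_of \<mu> t) = (\<Sum>\<pi>\<in>column_stabilizer n \<mu> t.
     if \<pi> = id then 1 else 0)"
    unfolding polytabloid_def sum_fun_apply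
    by (rule sum.cong) (auto simp: tabscale_def single_def sign_id dest: id)
  then show ?thesis using fin idm by simp
qed

lemma card_column_0:
  assumes t: "tableau n \<mu> t" and pos: "\<And>i. i < length \<mu> \<Longrightarrow> 0 < \<mu> ! i"
  shows "card (column \<mu> t 0) = length \<mu>"
proof -
  have "column \<mu> t 0 = (\<lambda>i. t (i, 0)) ` {..<length \<mu>}"
    using pos by (auto simp: column_def cells_def)
  moreover have "inj_on (\<lambda>i. t (i, 0)) {..<length \<mu>}"
    using tableau_eq_iff[OF t] pos by (auto simp: inj_on_def cells_def)
  ultimately show ?thesis by (simp add: card_image)
qed

section \<open>The Garnir relation for the first column\<close>

lemma transpose_o_transpose:
  assumes "x \<noteq> p"
  shows "transpose a b \<circ> transpose x p = transpose (transpose a b x) (transpose a b p) \<circ> transpose a b"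
  by (auto simp: fun_eq_iff transpose_def)

text \<open>
  The difference of both sides is antisymmetric under all permutations of the column together
  with \<open>p\<close>. This set has more elements than there are rows, so every tabloid is fixed by a
  transposition of two of them, and its coefficient vanishes.
\<close>

lemma garnir_column:
  assumes t: "tableau n \<mu> t" and pos: "\<And>i. i < length \<mu> \<Longrightarrow> 0 < \<mu> ! i"
    and p: "p \<in> {1..n}" "p \<notin> column \<mu> t 0"
  shows "(\<Sum>x\<in>column \<mu> t 0. act (transpose x p) (polytabloid n \<mu> t)) = polytabloid n \<mu> t"
proof -
  define C where "C = column \<mu> t 0"
  define E where "E = polytabloid n \<mu> t"
  define w where "w = E - (\<Sum>x\<in>C. act (transpose x p) E)"
  have sub: "insert p C \<subseteq> {1..n}" using column_subset[OF t] p by (auto simp: C_def)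
  have fin: "finite C" using finite_subset[OF sub] by simp
  have pC: "p \<notin> C" using p by (simp add: C_def)
  have E: "act (transpose a b) E = - E" if "a \<in> C" "b \<in> C" "a \<noteq> b" for a b
    using act_transpose_column[OF t] that unfolding C_def E_def by blast
  have comm: "act (transpose a b) (act (transpose x p) E) =
      act (transpose (transpose a b x) (transpose a b p)) (act (transpose a b) E)"
    if "x \<in> C" for a b x
    using that pC transpose_o_transpose[of x p a b] by (simp only: act_act bij_transpose) metis
  have anti1: "act (transpose a b) w = - w" if ab: "a \<in> C" "b \<in> C" "a \<noteq> b" for a b
  proof -
    \<comment> \<open>Since \<open>p\<close> is fixed by \<open>transpose a b\<close>, moving this
      transposition to the right replaces \<open>x\<close> by its image, and then it negates
      \<open>E\<close>. The images run through \<open>C\<close> again.\<close>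
    have "(\<Sum>x\<in>C. act (transpose a b) (act (transpose x p) E)) =
        (\<Sum>x\<in>C. - act (transpose (transpose a b x) p) E)"
      using ab pC by (intro sum.cong) (auto simp: comm E act_minus transpose_def)
    also have "\<dots> = (\<Sum>x\<in>C. - act (transpose x p) E)"
      using ab by (intro sum.reindex_bij_witness[where i = "transpose a b" and j = "transpose a b"])
        (auto simp: transpose_def)
    finally show ?thesis
      using ab by (simp add: w_def act_diff act_sum E sum_negf)
  qed
  have anti2: "act (transpose a p) w = - w" if a: "a \<in> C" for a
  proof -
    \<comment> \<open>For \<open>x \<noteq> a\<close>, \<open>(a p) (x p) = (x p) (a x)\<close>, and
      \<open>(a x)\<close> negates \<open>E\<close>. The two remaining terms of \<open>w\<close>,
      namely \<open>E\<close> and \<open>- (a p) E\<close>, are exchanged up to sign, so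
      \<open>w\<close> is negated as a whole.\<close>
    have "(\<Sum>x\<in>C - {a}. act (transpose a p) (act (transpose x p) E)) =
        (\<Sum>x\<in>C - {a}. - act (transpose x p) E)"
    proof (rule sum.cong[OF refl])
      fix x assume x: "x \<in> C - {a}"
      have "transpose a p \<circ> transpose x p = transpose x p \<circ> transpose a x"
        using x a pC by (auto simp: fun_eq_iff transpose_def)
      then have "act (transpose a p) (act (transpose x p) E) = act (transpose x p) (act (transpose a x) E)"
        by (simp add: act_act)
      then show "act (transpose a p) (act (transpose x p) E) = - act (transpose x p) E"
        using x a by (simp add: E act_minus)
    qed
    moreover have "act (transpose a p) (act (transpose a p) E) = E"
      by (simp add: act_act) (simp add: act_def)
    ultimately show ?thesis
      using a fin by (simp add: w_def act_diff act_add act_sum sum.remove[of C a] sum_negf)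
  qed
  have anti: "act (transpose a b) w = - w" if "a \<in> insert p C" "b \<in> insert p C" "a \<noteq> b" for a b
  proof (cases "a = p \<or> b = p")
    case True
    then show ?thesis using anti2[of a] anti2[of b] that by (auto simp: transpose_commute[of p])
  next
    case False
    then show ?thesis using anti1 that by simp
  qed
  have "w T = 0" for T
  proof (cases "row_partition n (length \<mu>) T")
    case True
    then obtain f where f: "\<forall>x\<in>{1..n}. f x < length \<mu>" "\<forall>i. T i = {x \<in> {1..n}. f x = i}"
      by (auto simp: row_partition_def)
    have "f ` insert p C \<subseteq> {..<length \<mu>}" using f sub by auto
    then have "card (f ` insert p C) \<le> length \<mu>"
      using card_mono[of "{..<length \<mu>}"] by simp
    also have "\<dots> < card (insert p C)"
      using card_column_0[OF t pos] fin pC by (simp add: C_def)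
    finally have "\<not> inj_on f (insert p C)" using pigeonhole by blast
    then obtain a b where ab: "a \<in> insert p C" "b \<in> insert p C" "a \<noteq> b" "f a = f b"
      by (auto simp only: inj_on_def)
    have "transpose a b ` T i = T i" for i
    proof -
      have "a \<in> T i \<longleftrightarrow> b \<in> T i" using f ab sub by auto
      then show ?thesis by (cases "a \<in> T i") auto
    qed
    then have "w T = act (transpose a b) w T" by (simp add: act_def)
    then show ?thesis using anti[OF ab(1-3)] by simp
  next
    case False
    \<comment> \<open>Every translate of \<open>E\<close> is itself a polytabloid and so vanishes at
      a \<open>T\<close> that is no row partition.\<close>
    have "act \<sigma> E T = 0" if "\<sigma> permutes {1..n}" for \<sigma>
      using polytabloid_support[OF tableau_comp[OF t that]] False
      by (auto simp: E_def act_polytabloid[OF that])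
    then have "act (transpose x p) E T = 0" if "x \<in> C" for x
      using sub that by (simp add: permutes_swap_id subset_iff)
    then show ?thesis
      using polytabloid_support[OF t] False by (auto simp: w_def E_def sum_fun_apply)
  qed
  then have "w = 0" by (simp add: fun_eq_iff)
  then show ?thesis by (simp add: w_def C_def E_def)
qed

section \<open>Linearity of the Laplacian\<close>

lemma laplacian_apply:
  "laplacian n A v T =
     (\<Sum>(i, j) | 1 \<le> i \<and> i < j \<and> j \<le> n. of_real (A i j) * (v T - act (transpose i j) v T))"
  unfolding laplacian_def sum_fun_apply by (rule sum.cong) (auto simp: tabscale_def)

lemma laplacian_add: "laplacian n A (u + v) = laplacian n A u + laplacian n A v"
  unfolding fun_eq_iff plus_fun_apply laplacian_apply sum.distrib[symmetric]
  by (intro allI sum.cong) (auto simp: act_def algebra_simps)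

lemma laplacian_scale: "laplacian n A (tabscale c v) = tabscale c (laplacian n A v)"
  unfolding fun_eq_iff tabscale_def laplacian_apply sum_distrib_left
  by (intro allI sum.cong) (auto simp: act_def algebra_simps)

lemma laplacian_zero: "laplacian n A 0 = 0"
  by (simp add: fun_eq_iff laplacian_apply act_def)

lemma laplacian_sum: "laplacian n A (\<Sum>x\<in>S. f x) = (\<Sum>x\<in>S. laplacian n A (f x))"
proof (induction S rule: infinite_finite_induct)
  case (insert x F)
  then show ?case by (simp add: laplacian_add del: plus_fun_apply)
qed (simp_all only: sum.infinite sum.empty laplacian_zero not_False_eq_True)

lemma laplacian_minus: "laplacian n A (- v) = - laplacian n A v"
  using laplacian_scale[of n A "-1" v] by (simp add: tabscale_def fun_eq_iff fun_Compl_def)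

lemma laplacian_diff: "laplacian n A (u - v) = laplacian n A u - laplacian n A v"
  using laplacian_add[of n A u "- v"] laplacian_minus[of n A v] by simp

section \<open>The star and its two candidate eigenvalues\<close>

definition star :: "nat \<Rightarrow> nat \<Rightarrow> real" where
  "star i j = (if i = 1 then 1 else 0)"

lemma laplacian_star:
  "laplacian n star v = (\<Sum>j\<in>{1..n} - {1}. v - act (transpose 1 j) v)"
proof
  fix T
  let ?S = "{(i, j). 1 \<le> i \<and> i < j \<and> j \<le> n}"
  have "finite ?S"
    by (rule finite_subset[of _ "{..n} \<times> {..n}"]) auto
  \<comment> \<open>Pairs with \<open>i \<noteq> 1\<close> have weight 0; the remaining ones are
    indexed by their second entry.\<close>
  then have "laplacian n star v T = (\<Sum>(i, j)\<in>Pair 1 ` ({1..n} - {1}). v T - act (transpose i j) v T)"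
    unfolding laplacian_apply by (intro sum.mono_neutral_cong_right) (auto simp: star_def)
  then show "laplacian n star v T = (\<Sum>j\<in>{1..n} - {1}. v - act (transpose 1 j) v) T"
    by (simp add: sum.reindex inj_on_def sum_fun_apply)
qed

lemma of_nat_card_Diff_singleton:
  assumes "finite S" "c \<in> S"
  shows "of_nat (card (S - {c})) = (of_nat (card S) - 1 :: 'a :: ring_1)"
  using card.remove[OF assms] by simp

text \<open>With column heights \<open>m = length \<mu>\<close> and \<open>k = n - m\<close> this is
  \<open>(m - 1) + 2 * (k - 1) = n + k - 3\<close>: the eigenvalue on polytabloids with 1 in the
  second column.\<close>

definition star_low :: "nat \<Rightarrow> nat list \<Rightarrow> real" where
  "star_low n \<mu> = 2 * real n - length \<mu> - 3"

text \<open>This is \<open>2 * (m - 1) + k\<close>: the diagonal coefficient when 1 lies in the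
  first column, which bounds the other possible eigenvalue.\<close>

definition star_high :: "nat \<Rightarrow> nat list \<Rightarrow> real" where
  "star_high n \<mu> = real n + length \<mu> - 2"

section \<open>Spectrum of the star on shapes with at most two columns\<close>

context
  fixes n :: nat and \<mu> :: "nat list"
  assumes parts: "set \<mu> \<subseteq> {1, 2}" and sum_parts: "sum_list \<mu> = n" and n_pos: "0 < n"
begin

lemma nth_parts: "i < length \<mu> \<Longrightarrow> \<mu> ! i = 1 \<or> \<mu> ! i = 2"
  using parts nth_mem by blast

text \<open>Parts are at most 2, so every entry lies in column 0 or 1; they are positive, so column
  0 meets every row. The height of column 1 is given as a complex number to avoid truncated
  subtraction.\<close>

lemma columns:
  assumes t: "tableau n \<mu> t"
  shows "{1..n} = column \<mu> t 0 \<union> column \<mu> t 1" "column \<mu> t 0 \<inter> column \<mu> t 1 = {}"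
    "card (column \<mu> t 0) = length \<mu>" "of_nat (card (column \<mu> t 1)) = (of_nat n - of_nat (length \<mu>) :: complex)"
proof -
  have "x \<in> column \<mu> t 0 \<union> column \<mu> t 1" if x: "x \<in> {1..n}" for x
  proof -
    obtain i j where ij: "(i, j) \<in> cells \<mu>" "x = t (i, j)"
      using tableau_surj[OF t x] by blast
    then have "j = 0 \<or> j = 1" using nth_parts[of i] by (auto simp: cells_def)
    then show ?thesis using ij by (auto simp: column_def)
  qed
  then show un: "{1..n} = column \<mu> t 0 \<union> column \<mu> t 1"
    using column_subset[OF t] by blast
  show disj: "column \<mu> t 0 \<inter> column \<mu> t 1 = {}"
    using column_disjoint[OF t, of _ 0 1] by auto
  have c0: "card (column \<mu> t 0) = length \<mu>"
    using nth_parts by (intro card_column_0[OF t]) fastforce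
  have fin: "finite (column \<mu> t 0)" "finite (column \<mu> t 1)"
    using un by (metis finite_Un finite_atLeastAtMost)+
  have "n = card (column \<mu> t 0) + card (column \<mu> t 1)"
    using card_Un_disjoint[OF fin disj] un by (metis card_atLeastAtMost diff_Suc_1)
  with c0 show "card (column \<mu> t 0) = length \<mu>"
    "of_nat (card (column \<mu> t 1)) = (of_nat n - of_nat (length \<mu>) :: complex)" by simp_all
qed

lemma sum_columns:
  assumes t: "tableau n \<mu> t" and c: "c \<in> {1..n}"
  shows "(\<Sum>j\<in>{1..n} - {c}. f j) = (\<Sum>j\<in>column \<mu> t 0 - {c}. f j) + (\<Sum>j\<in>column \<mu> t 1 - {c}. f j)"
proof -
  have "{1..n} - {c} = (column \<mu> t 0 - {c}) \<union> (column \<mu> t 1 - {c})"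
    using columns(1)[OF t] by blast
  moreover have "finite (column \<mu> t 0 - {c})" "finite (column \<mu> t 1 - {c})"
    using columns(1)[OF t] by (metis finite_Un finite_atLeastAtMost finite_Diff)+
  ultimately show ?thesis
    using columns(2)[OF t] by (simp only:) (intro sum.union_disjoint, auto)
qed

text \<open>The Garnir relation with \<open>p = 1\<close> collapses the sum over the first column to
  one copy of the polytabloid. Each transposition of 1 with another entry of the second column
  negates it and contributes 2.\<close>

lemma laplacian_star_column_1:
  assumes t: "tableau n \<mu> t" and c: "1 \<in> column \<mu> t 1"
  shows "laplacian n star (polytabloid n \<mu> t) = tabscale (star_low n \<mu>) (polytabloid n \<mu> t)"
proof
  fix T
  let ?E = "polytabloid n \<mu> t"
  have c1: "1 \<in> {1..n}" using c column_subset[OF t] by blast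
  have c0: "1 \<notin> column \<mu> t 0" using columns(2)[OF t] c by blast
  have pos: "0 < \<mu> ! i" if "i < length \<mu>" for i using nth_parts[OF that] by auto
  have fin: "finite (column \<mu> t 1)"
    using columns(1)[OF t] by (metis finite_Un finite_atLeastAtMost)
  have "(\<Sum>x\<in>column \<mu> t 0. act (transpose 1 x) ?E T) = ?E T"
    using fun_cong[OF garnir_column[OF t pos c1 c0], of T]
    by (simp add: sum_fun_apply transpose_commute[of _ "Suc 0"])
  then have "(\<Sum>j\<in>column \<mu> t 0 - {1}. ?E T - act (transpose 1 j) ?E T) = (of_nat (length \<mu>) - 1) * ?E T"
    using c0 columns(3)[OF t] by (simp add: sum_subtractf algebra_simps)
  moreover have "(\<Sum>j\<in>column \<mu> t 1 - {1}. ?E T - act (transpose 1 j) ?E T) =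
      (of_nat n - of_nat (length \<mu>) - 1) * (2 * ?E T)"
  proof -
    have "(\<Sum>j\<in>column \<mu> t 1 - {1}. ?E T - act (transpose 1 j) ?E T) =
        (\<Sum>j\<in>column \<mu> t 1 - {1}. 2 * ?E T)"
      using act_transpose_column[OF t c] by (intro sum.cong) auto
    then show ?thesis
      unfolding sum_constant of_nat_card_Diff_singleton[OF fin c] columns(4)[OF t] .
  qed
  ultimately show "laplacian n star ?E T = tabscale (star_low n \<mu>) ?E T"
    unfolding laplacian_star sum_fun_apply minus_apply sum_columns[OF t c1]
    by (simp only: plus_fun_apply) (simp add: tabscale_def star_low_def algebra_simps)
qed

text \<open>Transpositions inside the first column negate the polytabloid and contribute 2 each.
  Those with \<open>p\<close> in the second column contribute 1 each, minus a polytabloid that has 1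
  in its second column.\<close>

lemma laplacian_star_column_0:
  assumes t: "tableau n \<mu> t" and c: "1 \<in> column \<mu> t 0"
  shows "laplacian n star (polytabloid n \<mu> t) = tabscale (star_high n \<mu>) (polytabloid n \<mu> t)
    - (\<Sum>p\<in>column \<mu> t 1. polytabloid n \<mu> (transpose 1 p \<circ> t))"
proof
  fix T
  let ?E = "polytabloid n \<mu> t"
  have c1: "1 \<in> {1..n}" using c column_subset[OF t] by blast
  have c0: "1 \<notin> column \<mu> t 1" using columns(2)[OF t] c by blast
  have fin: "finite (column \<mu> t 0)"
    using columns(1)[OF t] by (metis finite_Un finite_atLeastAtMost)
  have "act (transpose 1 p) ?E = polytabloid n \<mu> (transpose 1 p \<circ> t)" if "p \<in> column \<mu> t 1" for p
    using c1 subsetD[OF column_subset[OF t] that] by (intro act_polytabloid permutes_swap_id)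
  then have "(\<Sum>j\<in>column \<mu> t 1 - {1}. ?E T - act (transpose 1 j) ?E T) =
      (of_nat n - of_nat (length \<mu>)) * ?E T - (\<Sum>p\<in>column \<mu> t 1. polytabloid n \<mu> (transpose 1 p \<circ> t) T)"
    using c0 columns(4)[OF t] by (simp add: sum_subtractf)
  moreover have "(\<Sum>j\<in>column \<mu> t 0 - {1}. ?E T - act (transpose 1 j) ?E T) =
      (of_nat (length \<mu>) - 1) * (2 * ?E T)"
  proof -
    have "(\<Sum>j\<in>column \<mu> t 0 - {1}. ?E T - act (transpose 1 j) ?E T) =
        (\<Sum>j\<in>column \<mu> t 0 - {1}. 2 * ?E T)"
      using act_transpose_column[OF t c] by (intro sum.cong) auto
    then show ?thesis
      unfolding sum_constant of_nat_card_Diff_singleton[OF fin c] columns(3)[OF t] .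
  qed
  ultimately show "laplacian n star ?E T =
      (tabscale (star_high n \<mu>) ?E - (\<Sum>p\<in>column \<mu> t 1. polytabloid n \<mu> (transpose 1 p \<circ> t))) T"
    unfolding laplacian_star sum_fun_apply minus_apply sum_columns[OF t c1]
    by (simp only: plus_fun_apply) (simp add: tabscale_def star_high_def algebra_simps)
qed

text \<open>This is \<open>(\<Delta> - star_low) (\<Delta> - star_high) = 0\<close> on the Specht
  module. The vectors satisfying it form a subspace, so it suffices to check polytabloids: \<Delta>
  - \<open>star_high\<close> sends each of them into the \<open>star_low\<close> eigenspace.\<close>

lemma laplacian_star_quadratic:
  assumes "v \<in> specht n \<mu>"
  defines "u \<equiv> laplacian n star v - tabscale (star_high n \<mu>) v"
  shows "laplacian n star u = tabscale (star_low n \<mu>) u"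
proof -
  define D where "D v = laplacian n star v - tabscale (star_high n \<mu>) v" for v
  define Q where "Q v \<longleftrightarrow> laplacian n star (D v) = tabscale (star_low n \<mu>) (D v)" for v
  have D0: "D 0 = 0" and Da: "D (v + w) = D v + D w" and Ds: "D (tabscale c v) = tabscale c (D v)"
    for v w c
    unfolding D_def laplacian_zero laplacian_add laplacian_scale
    by (auto simp: fun_eq_iff tabscale_def algebra_simps)
  have "tabvec.subspace (Collect Q)"
    unfolding tabvec.subspace_def
    by (auto simp: Q_def D0 Da Ds laplacian_zero laplacian_add laplacian_scale
        tabvec.scale_right_distrib tabvec.scale_left_commute simp del: plus_fun_apply)
  moreover have "Q (polytabloid n \<mu> t)" if t: "tableau n \<mu> t" for t
  proof (cases "1 \<in> column \<mu> t 1")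
    case True
    show ?thesis
      by (simp only: Q_def D_def laplacian_star_column_1[OF t True] laplacian_diff laplacian_scale
          tabvec.scale_right_diff_distrib tabvec.scale_left_commute)
  next
    case False
    have "1 \<in> {1..n}" using n_pos by simp
    then have c: "1 \<in> column \<mu> t 0" using False columns(1)[OF t] by blast
    have D: "D (polytabloid n \<mu> t) = - (\<Sum>p\<in>column \<mu> t 1. polytabloid n \<mu> (transpose 1 p \<circ> t))"
    proof -
      have "a - b - a = - b" for a b :: tabvec by (simp add: fun_eq_iff)
      then show ?thesis unfolding D_def laplacian_star_column_0[OF t c] .
    qed
    \<comment> \<open>Swapping 1 with \<open>p\<close> moves 1 into the second column, where the
      eigenvector case applies.\<close>
    have "laplacian n star (polytabloid n \<mu> (transpose 1 p \<circ> t)) =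
        tabscale (star_low n \<mu>) (polytabloid n \<mu> (transpose 1 p \<circ> t))" if p: "p \<in> column \<mu> t 1" for p
    proof (rule laplacian_star_column_1)
      show "tableau n \<mu> (transpose 1 p \<circ> t)"
        using n_pos subsetD[OF column_subset[OF t] p] by (intro tableau_comp[OF t] permutes_swap_id) simp_all
      show "1 \<in> column \<mu> (transpose 1 p \<circ> t) 1"
        unfolding column_comp by (rule image_eqI[OF _ p]) simp
    qed
    then show ?thesis
      by (simp add: Q_def D laplacian_minus laplacian_sum tabvec.scale_sum_right)
  qed
  ultimately have "Q v"
    using assms(1) unfolding specht_def
    by (elim tabvec.span_induct) auto
  then show ?thesis by (simp add: Q_def D_def u_def)
qed

lemma exists_tableau: "\<exists>t. tableau n \<mu> t"
proof -
  have "cells \<mu> = (SIGMA i:{..<length \<mu>}. {..<\<mu> ! i})"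
    by (auto simp: cells_def)
  then have "finite (cells \<mu>)" "card (cells \<mu>) = n"
    using sum_parts by (simp_all add: sum_list_sum_nth atLeast0LessThan)
  then show ?thesis
    unfolding tableau_def by (intro finite_same_card_bij) auto
qed

text \<open>The quadratic relation leaves two possible eigenvalues. A part 2 makes the second column
  nonempty, so the lower one is attained.\<close>

lemma lambda1_star:
  assumes "2 \<in> set \<mu>"
  shows "lambda1 n star \<mu> = star_low n \<mu>"
proof -
  define S where "S = {l. \<exists>v\<in>specht n \<mu>. v \<noteq> 0 \<and> laplacian n star v = tabscale (of_real l) v}"
  have sub: "S \<subseteq> {star_low n \<mu>, star_high n \<mu>}"
  proof
    fix l assume "l \<in> S"
    then obtain v where v: "v \<in> specht n \<mu>" "v \<noteq> 0" "laplacian n star v = tabscale (of_real l) v"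
      by (auto simp: S_def)
    then obtain T where T: "v T \<noteq> 0" by (auto simp: fun_eq_iff)
    \<comment> \<open>Evaluated at a tabloid where \<open>v\<close> is nonzero, the quadratic
      relation becomes an equation for the scalar \<open>l\<close>.\<close>
    have "(of_real l - of_real (star_high n \<mu>)) * (of_real l * v T) =
        of_real (star_low n \<mu>) * ((of_real l - of_real (star_high n \<mu>)) * v T)"
      using fun_cong[OF laplacian_star_quadratic[OF v(1)], of T]
      unfolding laplacian_diff laplacian_scale v(3)
      by (simp add: tabscale_def algebra_simps)
    then have "(of_real l - of_real (star_high n \<mu>)) * (of_real l - of_real (star_low n \<mu>)) = (0 :: complex)"
      using T by algebra
    then show "l \<in> {star_low n \<mu>, star_high n \<mu>}" by auto
  qed
  obtain i where i: "i < length \<mu>" "\<mu> ! i = 2" using assms by (auto simp: in_set_conv_nth)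
  obtain s where s: "tableau n \<mu> s" using exists_tableau by blast
  \<comment> \<open>Relabelling puts 1 into the second cell of a row of length 2.\<close>
  define t where "t = transpose 1 (s (i, 1)) \<circ> s"
  have cell: "(i, 1) \<in> cells \<mu>" using i by (simp add: cells_def)
  have t: "tableau n \<mu> t"
    unfolding t_def using tableau_in_range[OF s cell] by (intro tableau_comp[OF s] permutes_swap_id) auto
  have "t (i, 1) = 1" by (simp add: t_def)
  then have "1 \<in> column \<mu> t 1" using cell by (force simp: column_def)
  then have "laplacian n star (polytabloid n \<mu> t) = tabscale (star_low n \<mu>) (polytabloid n \<mu> t)"
    by (rule laplacian_star_column_1[OF t])
  moreover have "polytabloid n \<mu> t \<in> specht n \<mu>"
    unfolding specht_def using t by (intro tabvec.span_base) blast
  moreover have "polytabloid n \<mu> t \<noteq> 0"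
    using polytabloid_tabloid_of[OF t] by auto
  ultimately have mem: "star_low n \<mu> \<in> S" by (auto simp: S_def)
  \<comment> \<open>This gives \<open>n \<le> 2 * m\<close>, while
    \<open>star_high - star_low = 2 * m - n + 1\<close>.\<close>
  have "sum_list xs \<le> 2 * length xs" if "set xs \<subseteq> {1, 2}" for xs :: "nat list"
    using that by (induction xs) auto
  from this[OF parts] have "star_low n \<mu> \<le> star_high n \<mu>" using sum_parts by (simp add: star_low_def star_high_def)
  then show ?thesis
    unfolding lambda1_def S_def[symmetric] using sub mem
    by (intro Min_eqI) (auto intro: finite_subset)
qed

end

section \<open>Comparison of the two shapes\<close>

theorem corollary1:
  fixes n :: nat
  assumes "n \<ge> 4"
  shows "\<not> aldous_greater n (2 # 2 # replicate (n - 4) 1) (2 # replicate (n - 2) 1)"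
proof -
  \<comment> \<open>The shape has \<open>n - 2\<close> rows and the next one \<open>n - 1\<close>;
    one row fewer raises \<open>star_low\<close> by 1.\<close>
  have "lambda1 n star (2 # 2 # replicate (n - 4) 1) = n - 1"
    using assms by (subst lambda1_star) (auto simp: star_low_def sum_list_replicate)
  moreover have "lambda1 n star (2 # replicate (n - 2) 1) = n - 2"
    using assms by (subst lambda1_star) (auto simp: star_low_def sum_list_replicate)
  \<comment> \<open>At the star the order would demand \<open>n - 2 \<ge> n - 1\<close>.\<close>
  ultimately have "\<not> aldous_le n (2 # replicate (n - 2) 1) (2 # 2 # replicate (n - 4) 1)"
    using assms unfolding aldous_le_def
    by (intro notI) (drule spec[of _ star], auto simp: star_def split: if_splits)
  then show ?thesis
    unfolding aldous_greater_def by blast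
qed

end
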